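(* Let $f:A\to B$ and $g:A\to C$ be ring homomorphisms, and let $J$ be an ideal of $B$ and $J'$ an ideal of $C$ such that $f^{-1}(J)=g^{-1}(J')$. Then the following assertions are equivalent: \begin{enumerate} \item $A\bowtie^{f,g}(J,J')$ is a domain; \item either ($J=0$ and $g(A)+J'$ is a domain) or ($J'=0$ and $f(A)+J$ is a domain). \end{enumerate}
   Context: All rings are commutative with unity, and ring homomorphisms are unital. The bi-amalgamation of $A$ with $(B,C)$ along $(J,J')$ with respect to $(f,g)$ is the subring of $B\times C$ $$A\bowtie^{f,g}(J,J'):=\{(f(a)+j,\,g(a)+j')\mid a\in A,\ (j,j')\in J\times J'\}.$$ Here $f(A)+J=\{f(a)+j\mid a\in A, j\in J\}$ is a subring of $B$ and $g(A)+J'$ is a subring of $C$ (defined analogously). The "or" in (2) is inclusive. *)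

theory Defs
  imports "HOL-Algebra.Chinese_Remainder" "HOL-Algebra.Subrings"
begin

definition bi_amalg_set ::
    "('a, 'm) ring_scheme \<Rightarrow> ('b, 'n) ring_scheme \<Rightarrow> ('c, 'p) ring_scheme \<Rightarrow>
      ('a \<Rightarrow> 'b) \<Rightarrow> ('a \<Rightarrow> 'c) \<Rightarrow> 'b set \<Rightarrow> 'c set \<Rightarrow> ('b \<times> 'c) set"
  where "bi_amalg_set A B C f g J J' =
    {(f a \<oplus>\<^bsub>B\<^esub> j, g a \<oplus>\<^bsub>C\<^esub> j') | a j j'. a \<in> carrier A \<and> (j, j') \<in> J \<times> J'}"

definition bi_amalg ::
    "('a, 'm) ring_scheme \<Rightarrow> ('b, 'n) ring_scheme \<Rightarrow> ('c, 'p) ring_scheme \<Rightarrow>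
      ('a \<Rightarrow> 'b) \<Rightarrow> ('a \<Rightarrow> 'c) \<Rightarrow> 'b set \<Rightarrow> 'c set \<Rightarrow> ('b \<times> 'c) ring"
  where "bi_amalg A B C f g J J' =
    (RDirProd B C) \<lparr>carrier := bi_amalg_set A B C f g J J'\<rparr>"

definition hom_image_plus_ideal ::
    "('a, 'm) ring_scheme \<Rightarrow> ('b, 'n) ring_scheme \<Rightarrow> ('a \<Rightarrow> 'b) \<Rightarrow> 'b set \<Rightarrow> ('b, 'n) ring_scheme"
  where "hom_image_plus_ideal A B f J = B \<lparr>carrier := f ` carrier A <+>\<^bsub>B\<^esub> J\<rparr>"

lemma subring_hom_image_plus_ideal:
  assumes "cring A" "cring B" "f \<in> ring_hom A B" "ideal J B"
  shows "subring (f ` carrier A <+>\<^bsub>B\<^esub> J) B"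
proof -
  interpret A: cring A by fact
  interpret B: cring B by fact
  interpret J: ideal J B by fact
  interpret f: ring_hom_cring A B f
    by (rule ring_hom_cring.intro[OF _ _ ring_hom_cring_axioms.intro]) (fact assms)+
  have mem: "x \<in> f ` carrier A <+>\<^bsub>B\<^esub> J \<longleftrightarrow> (\<exists>a\<in>carrier A. \<exists>j\<in>J. x = f a \<oplus>\<^bsub>B\<^esub> j)" for x
    by (auto simp: set_add_def')
  show ?thesis
  proof (rule B.subringI)
    show "f ` carrier A <+>\<^bsub>B\<^esub> J \<subseteq> carrier B"
      using J.a_subset by (auto simp: mem)
    show "\<one>\<^bsub>B\<^esub> \<in> f ` carrier A <+>\<^bsub>B\<^esub> J"
      unfolding mem by (rule bexI[of _ "\<one>\<^bsub>A\<^esub>"], rule bexI[of _ "\<zero>\<^bsub>B\<^esub>"]) auto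
  next
    fix h assume "h \<in> f ` carrier A <+>\<^bsub>B\<^esub> J"
    then obtain a j where *: "a \<in> carrier A" "j \<in> J" "h = f a \<oplus>\<^bsub>B\<^esub> j"
      unfolding mem by blast
    then show "\<ominus>\<^bsub>B\<^esub> h \<in> f ` carrier A <+>\<^bsub>B\<^esub> J"
      unfolding mem using J.Icarr
      by (intro bexI[of _ "\<ominus>\<^bsub>A\<^esub> a"] bexI[of _ "\<ominus>\<^bsub>B\<^esub> j"]) (auto simp: B.minus_add)
  next
    fix h k assume "h \<in> f ` carrier A <+>\<^bsub>B\<^esub> J" "k \<in> f ` carrier A <+>\<^bsub>B\<^esub> J"
    then obtain a j b i where *: "a \<in> carrier A" "j \<in> J" "h = f a \<oplus>\<^bsub>B\<^esub> j"
        "b \<in> carrier A" "i \<in> J" "k = f b \<oplus>\<^bsub>B\<^esub> i"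
      unfolding mem by blast
    have c: "j \<in> carrier B" "i \<in> carrier B" "f a \<in> carrier B" "f b \<in> carrier B"
      using * J.Icarr by auto
    have eq: "h \<otimes>\<^bsub>B\<^esub> k = f (a \<otimes>\<^bsub>A\<^esub> b) \<oplus>\<^bsub>B\<^esub> (f a \<otimes>\<^bsub>B\<^esub> i \<oplus>\<^bsub>B\<^esub> j \<otimes>\<^bsub>B\<^esub> (f b \<oplus>\<^bsub>B\<^esub> i))"
      using * c by (simp add: B.l_distr B.r_distr B.a_ac)
    have "f a \<otimes>\<^bsub>B\<^esub> i \<oplus>\<^bsub>B\<^esub> j \<otimes>\<^bsub>B\<^esub> (f b \<oplus>\<^bsub>B\<^esub> i) \<in> J"
      using * c by (intro J.a_closed J.I_l_closed J.I_r_closed) auto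
    then show "h \<otimes>\<^bsub>B\<^esub> k \<in> f ` carrier A <+>\<^bsub>B\<^esub> J"
      unfolding mem eq using * by blast
    have "h \<oplus>\<^bsub>B\<^esub> k = f (a \<oplus>\<^bsub>A\<^esub> b) \<oplus>\<^bsub>B\<^esub> (j \<oplus>\<^bsub>B\<^esub> i)"
      using * c by (simp add: B.a_ac)
    then show "h \<oplus>\<^bsub>B\<^esub> k \<in> f ` carrier A <+>\<^bsub>B\<^esub> J"
      unfolding mem using * J.a_closed by blast
  qed
qed

lemma RDirProd_simps:
  "\<zero>\<^bsub>RDirProd B C\<^esub> = (\<zero>\<^bsub>B\<^esub>, \<zero>\<^bsub>C\<^esub>)"
  "\<one>\<^bsub>RDirProd B C\<^esub> = (\<one>\<^bsub>B\<^esub>, \<one>\<^bsub>C\<^esub>)"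
  "(x, y) \<oplus>\<^bsub>RDirProd B C\<^esub> (x', y') = (x \<oplus>\<^bsub>B\<^esub> x', y \<oplus>\<^bsub>C\<^esub> y')"
  "(x, y) \<otimes>\<^bsub>RDirProd B C\<^esub> (x', y') = (x \<otimes>\<^bsub>B\<^esub> x', y \<otimes>\<^bsub>C\<^esub> y')"
  by (auto simp: RDirProd_def DirProd_def monoid.defs)

lemma bi_amalg_set_eq:
  "bi_amalg_set A B C f g J J' =
    (\<lambda>a. (f a, g a)) ` carrier A <+>\<^bsub>RDirProd B C\<^esub> (J \<times> J')"
  by (force simp: bi_amalg_set_def set_add_def' RDirProd_simps)

lemma subring_bi_amalg_set:
  assumes A: "cring A" and B: "cring B" and C: "cring C"
    and f: "f \<in> ring_hom A B" and g: "g \<in> ring_hom A C"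
    and J: "ideal J B" and J': "ideal J' C"
  shows "subring (bi_amalg_set A B C f g J J') (RDirProd B C)"
proof -
  interpret B: cring B by fact
  interpret C: cring C by fact
  interpret J: ideal J B by fact
  interpret J': ideal J' C by fact
  interpret P: ring "RDirProd B C" by (rule RDirProd_ring) unfold_locales
  have P: "cring (RDirProd B C)"
    by unfold_locales (auto simp: RDirProd_carrier RDirProd_simps B.m_comm C.m_comm)
  have h: "(\<lambda>a. (f a, g a)) \<in> ring_hom A (RDirProd B C)"
    using f g by (auto simp: ring_hom_def RDirProd_carrier RDirProd_simps)
  have "ideal (J \<times> J') (RDirProd B C)"
  proof (rule idealI)
    show "ring (RDirProd B C)" by (rule P.ring_axioms)
    show "subgroup (J \<times> J') (add_monoid (RDirProd B C))"
      unfolding RDirProd_add_monoid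
      by (intro DirProd_subgroups B.add.is_group C.add.is_group J.a_subgroup J'.a_subgroup)
  next
    fix a x assume "a \<in> J \<times> J'" "x \<in> carrier (RDirProd B C)"
    then show "x \<otimes>\<^bsub>RDirProd B C\<^esub> a \<in> J \<times> J'" "a \<otimes>\<^bsub>RDirProd B C\<^esub> x \<in> J \<times> J'"
      by (auto simp: RDirProd_carrier RDirProd_simps J.I_l_closed J.I_r_closed J'.I_l_closed J'.I_r_closed)
  qed
  from subring_hom_image_plus_ideal[OF A P h this] show ?thesis
    by (simp add: bi_amalg_set_eq)
qed

end

theory Submission
  imports Defs
begin

text \<open>
  If \<open>j \<in> J\<close> and \<open>j' \<in> J'\<close> then \<open>(j, 0)\<close> and \<open>(0, j')\<close> lie in the bi-amalgamation and their
  product is zero, so in a domain one of the two ideals vanishes. When \<open>J = 0\<close>, the projection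
  onto the second coordinate is injective on the bi-amalgamation: if \<open>g a + j' = 0\<close> then
  \<open>a \<in> g\<^sup>-\<^sup>1(J') = f\<^sup>-\<^sup>1(0)\<close>, so \<open>f a = 0\<close>. As its image is \<open>g(A) + J'\<close>, the two rings are isomorphic;
  the case \<open>J' = 0\<close> is symmetric.
\<close>

text \<open>A subring inherits commutativity, so only nontriviality and the absence of zero divisors
  remain. Both are stated with the operations of the ambient ring, which lets domains with different
  carriers be compared.\<close>

lemma (in cring) subring_domain_iff:
  assumes "subring H R"
  shows "domain (R \<lparr> carrier := H \<rparr>) \<longleftrightarrow>
    \<one> \<noteq> \<zero> \<and> (\<forall>x\<in>H. \<forall>y\<in>H. x \<otimes> y = \<zero> \<longrightarrow> x = \<zero> \<or> y = \<zero>)"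
  using subdomain_iff[OF subringE(1)[OF assms]] subcringI'[OF assms]
  by (auto simp: subdomain_def subdomain_axioms_def)

text \<open>A trivial kernel on \<open>H\<close> makes the restriction of \<open>h\<close> an
  isomorphism onto its image. Nothing is asked of \<open>h\<close> outside \<open>H\<close>, so a
  projection qualifies even when it is far from injective on the whole product.\<close>

lemma (in ring_hom_cring) domain_img_iff:
  assumes H: "subring H R" and ker: "\<And>x. x \<in> H \<Longrightarrow> h x = \<zero>\<^bsub>S\<^esub> \<Longrightarrow> x = \<zero>"
  shows "domain (R \<lparr> carrier := H \<rparr>) \<longleftrightarrow> domain (S \<lparr> carrier := h ` H \<rparr>)"
proof -
  note HR = subringE(1)[OF H, THEN subsetD]
  have zero: "h x = \<zero>\<^bsub>S\<^esub> \<longleftrightarrow> x = \<zero>" if "x \<in> H" for x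
    using ker[OF that] hom_zero by metis
  \<comment> \<open>Closure of \<open>H\<close> under products lets the kernel condition be applied
    to the product itself; \<open>one\<close> below uses it at the unit in the same way.\<close>
  have mult: "h x \<otimes>\<^bsub>S\<^esub> h y = \<zero>\<^bsub>S\<^esub> \<longleftrightarrow> x \<otimes> y = \<zero>" if "x \<in> H" "y \<in> H" for x y
    using zero[OF subringE(6)[OF H that]] hom_mult[OF HR[OF that(1)] HR[OF that(2)]] by metis
  have one: "\<one>\<^bsub>S\<^esub> = \<zero>\<^bsub>S\<^esub> \<longleftrightarrow> \<one> = \<zero>"
    using zero[OF subringE(3)[OF H]] hom_one by metis
  show ?thesis
    unfolding R.subring_domain_iff[OF H] S.subring_domain_iff[OF ring.img_is_subring[OF H]]
    by (simp only: ball_simps one mult zero cong: ball_cong)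
qed

lemma cring_RDirProd:
  assumes "cring R" and "cring S"
  shows "cring (RDirProd R S)"
proof -
  interpret R: cring R by fact
  interpret S: cring S by fact
  interpret ring "RDirProd R S" by (rule RDirProd_ring) unfold_locales
  show ?thesis
    by unfold_locales (auto simp: RDirProd_carrier RDirProd_simps R.m_comm S.m_comm)
qed

lemma fst_ring_hom: "fst \<in> ring_hom (RDirProd R S) R"
  by (auto simp: ring_hom_def RDirProd_carrier RDirProd_simps)

lemma snd_ring_hom: "snd \<in> ring_hom (RDirProd R S) S"
  by (auto simp: ring_hom_def RDirProd_carrier RDirProd_simps)

text \<open>Some \<open>j'\<close> in \<open>J'\<close> is needed to complete \<open>f a\<close>
  plus \<open>j\<close> to a pair of the bi-amalgamation.\<close>

lemma fst_bi_amalg_set: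
  assumes "J' \<noteq> {}"
  shows "fst ` bi_amalg_set A B C f g J J' = f ` carrier A <+>\<^bsub>B\<^esub> J"
proof -
  obtain j' where "j' \<in> J'" using assms by blast
  then have "f a \<oplus>\<^bsub>B\<^esub> j \<in> fst ` bi_amalg_set A B C f g J J'" if "a \<in> carrier A" "j \<in> J" for a j
    using that unfolding bi_amalg_set_def
    by (intro image_eqI[of _ _ "(f a \<oplus>\<^bsub>B\<^esub> j, g a \<oplus>\<^bsub>C\<^esub> j')"]) auto
  then show ?thesis by (fastforce simp: bi_amalg_set_def set_add_def')
qed

lemma snd_bi_amalg_set:
  assumes "J \<noteq> {}"
  shows "snd ` bi_amalg_set A B C f g J J' = g ` carrier A <+>\<^bsub>C\<^esub> J'"
proof -
  obtain j where "j \<in> J" using assms by blast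
  then have "g a \<oplus>\<^bsub>C\<^esub> j' \<in> snd ` bi_amalg_set A B C f g J J'" if "a \<in> carrier A" "j' \<in> J'" for a j'
    using that unfolding bi_amalg_set_def
    by (intro image_eqI[of _ _ "(f a \<oplus>\<^bsub>B\<^esub> j, g a \<oplus>\<^bsub>C\<^esub> j')"]) auto
  then show ?thesis by (fastforce simp: bi_amalg_set_def set_add_def')
qed

text \<open>Turns the vanishing of a coordinate such as \<open>g a\<close> plus \<open>j'\<close>
  into membership of \<open>g a\<close> in the ideal.\<close>

lemma (in abelian_subgroup) add_zero_memD:
  assumes "x \<in> carrier G" "h \<in> H" "x \<oplus> h = \<zero>"
  shows "x \<in> H"
proof -
  have "x = \<ominus> h" using assms a_Hcarr by (simp add: minus_equality)
  then show ?thesis using assms(2) by simp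
qed

theorem proposition4p5:
  fixes A :: "('a, 'm) ring_scheme" and B :: "('b, 'n) ring_scheme" and C :: "('c, 'p) ring_scheme"
    and f :: "'a \<Rightarrow> 'b" and g :: "'a \<Rightarrow> 'c" and J :: "'b set" and J' :: "'c set"
  assumes "cring A" and "cring B" and "cring C"
    and "f \<in> ring_hom A B" and "g \<in> ring_hom A C"
    and "ideal J B" and "ideal J' C"
    and "f -` J \<inter> carrier A = g -` J' \<inter> carrier A"
  shows "domain (bi_amalg A B C f g J J') \<longleftrightarrow>
    (J = {\<zero>\<^bsub>B\<^esub>} \<and> domain (hom_image_plus_ideal A C g J')) \<or>
    (J' = {\<zero>\<^bsub>C\<^esub>} \<and> domain (hom_image_plus_ideal A B f J))"
proof -
  interpret B: cring B by fact
  interpret C: cring C by fact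
  interpret J: ideal J B by fact
  interpret J': ideal J' C by fact
  interpret f: ring_hom_cring A B f
    by (rule ring_hom_cring.intro[OF _ _ ring_hom_cring_axioms.intro]) (fact assms)+
  interpret g: ring_hom_cring A C g
    by (rule ring_hom_cring.intro[OF _ _ ring_hom_cring_axioms.intro]) (fact assms)+
  let ?P = "RDirProd B C" and ?S = "bi_amalg_set A B C f g J J'"
  interpret P: cring ?P by (rule cring_RDirProd) fact+
  interpret p: ring_hom_cring ?P B fst
    by unfold_locales (rule fst_ring_hom)
  interpret q: ring_hom_cring ?P C snd
    by unfold_locales (rule snd_ring_hom)
  have S: "subring ?S ?P" by (rule subring_bi_amalg_set) fact+
  have preimage: "f a \<in> J \<longleftrightarrow> g a \<in> J'" if "a \<in> carrier A" for a
    using assms(8) that by blast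
  have J0: "domain (bi_amalg A B C f g J J') \<longleftrightarrow> domain (hom_image_plus_ideal A C g J')"
    if J: "J = {\<zero>\<^bsub>B\<^esub>}"
  proof -
    \<comment> \<open>This is the \<open>ker\<close> condition of \<open>domain_img_iff\<close> for
      \<open>snd\<close>. The equality of the two preimages enters through \<open>preimage\<close>:
      it carries \<open>g a\<close> in \<open>J'\<close> over to \<open>f a\<close> in
      \<open>J\<close>, which is zero here.\<close>
    have "x = \<zero>\<^bsub>?P\<^esub>" if x: "x \<in> ?S" "snd x = \<zero>\<^bsub>C\<^esub>" for x
    proof -
      obtain a j' where a: "a \<in> carrier A" "j' \<in> J'" "x = (f a \<oplus>\<^bsub>B\<^esub> \<zero>\<^bsub>B\<^esub>, g a \<oplus>\<^bsub>C\<^esub> j')"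
        using x(1) J by (auto simp: bi_amalg_set_def)
      have "g a \<in> J'" using a x(2) by (intro J'.add_zero_memD[of "g a" j']) auto
      then show ?thesis using a x(2) preimage[of a] J by (auto simp: RDirProd_simps)
    qed
    then show ?thesis
      using q.domain_img_iff[OF S] snd_bi_amalg_set[of J A B C f g J'] J
      by (simp add: bi_amalg_def hom_image_plus_ideal_def)
  qed
  have J'0: "domain (bi_amalg A B C f g J J') \<longleftrightarrow> domain (hom_image_plus_ideal A B f J)"
    if J': "J' = {\<zero>\<^bsub>C\<^esub>}"
  proof -
    have "x = \<zero>\<^bsub>?P\<^esub>" if x: "x \<in> ?S" "fst x = \<zero>\<^bsub>B\<^esub>" for x
    proof -
      obtain a j where a: "a \<in> carrier A" "j \<in> J" "x = (f a \<oplus>\<^bsub>B\<^esub> j, g a \<oplus>\<^bsub>C\<^esub> \<zero>\<^bsub>C\<^esub>)"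
        using x(1) J' by (auto simp: bi_amalg_set_def)
      have "f a \<in> J" using a x(2) by (intro J.add_zero_memD[of "f a" j]) auto
      then show ?thesis using a x(2) preimage[of a] J' by (auto simp: RDirProd_simps)
    qed
    then show ?thesis
      using p.domain_img_iff[OF S] fst_bi_amalg_set[of J' A B C f g J] J'
      by (simp add: bi_amalg_def hom_image_plus_ideal_def)
  qed
  have "J = {\<zero>\<^bsub>B\<^esub>} \<or> J' = {\<zero>\<^bsub>C\<^esub>}" if "domain (bi_amalg A B C f g J J')"
  proof (rule ccontr)
    assume "\<not> ?thesis"
    then obtain j j' where j: "j \<in> J" "j \<noteq> \<zero>\<^bsub>B\<^esub>" "j' \<in> J'" "j' \<noteq> \<zero>\<^bsub>C\<^esub>"
      using J.zero_closed J'.zero_closed by blast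
    \<comment> \<open>Choosing zero of \<open>A\<close> as the ring element puts all of the product
      of \<open>J\<close> and \<open>J'\<close> inside the bi-amalgamation.\<close>
    have mem: "(x, y) \<in> ?S" if "x \<in> J" "y \<in> J'" for x y
    proof -
      have "x = f \<zero>\<^bsub>A\<^esub> \<oplus>\<^bsub>B\<^esub> x" "y = g \<zero>\<^bsub>A\<^esub> \<oplus>\<^bsub>C\<^esub> y"
        using that J.Icarr J'.Icarr by simp_all
      then show ?thesis
        unfolding bi_amalg_set_def using that f.R.zero_closed by blast
    qed
    have "(j, \<zero>\<^bsub>C\<^esub>) \<otimes>\<^bsub>?P\<^esub> (\<zero>\<^bsub>B\<^esub>, j') = \<zero>\<^bsub>?P\<^esub>"
      using j by (simp add: RDirProd_simps)
    then have "(j, \<zero>\<^bsub>C\<^esub>) = \<zero>\<^bsub>?P\<^esub> \<or> (\<zero>\<^bsub>B\<^esub>, j') = \<zero>\<^bsub>?P\<^esub>"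
      using that P.subring_domain_iff[OF S] mem[OF j(1) J'.zero_closed] mem[OF J.zero_closed j(3)]
      unfolding bi_amalg_def by blast
    then show False using j by (simp add: RDirProd_simps)
  qed
  \<comment> \<open>The equivalences \<open>J0\<close> and \<open>J'0\<close> serve both directions;
    the zero divisor argument only ensures that one of them applies.\<close>
  then show ?thesis using J0 J'0 by blast
qed

end
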